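(* Let $m>1$ be a divisor of a positive integer $n$ and write $n=n_1n_2$, where $\mathrm{rad}(n_1)$ divides $\frac nm$ and $\gcd\left(n_2,\frac nm\right)=1$. Let $(\vec a,\vec b,\vec c)$ be an $(n,m)$-admissible triple and $\pi$ be the $(n,m)$-p.a.p. with parameters $(\vec a,\vec b,\vec c)$. For each $1\le i\le m$, let $A_i\in[1,n_1]$ be such that $A_i\cdot a_{i-1}\equiv1\pmod{n_1}$. Then, for each $1\le i\le m$, the system of congruences $$\begin{cases}x\equiv c_{i-1}-A_ic_i\pmod m\\ x\equiv -A_ib_{i-1}\pmod{n_1}\end{cases}$$ admits a solution $B_i\in[1,n]$. Also, if $\vec A=(A_m,A_{m-1},\ldots,A_1)$, $\vec B=(B_m,B_{m-1},\ldots,B_1)$ and $\vec C=(c_m,c_{m-1},\ldots,c_1)$, then the triple $(\vec A,\vec B,\vec C)$ is $(n,m)$-admissible and the permutation $\pi^{-1}$ induced by such triple is the inverse of $\pi$, i.e., $\pi(\pi^{-1}(y))=\pi^{-1}(\pi(y))=y$ for all $y\in[1,n]$.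
   Context: For a positive integer $k$, $[1,k]=\{1,\dots,k\}$. For an integer $k>1$ and a positive integer $a$, $\Psi_k(a)$ is the unique element of $[1,k]$ congruent to $a$ modulo $k$. $\mathcal C(m)$ is the set of vectors $\vec c\in[1,m]^m$ whose entries comprise a permutation of $[1,m]$. The $i$-th coordinate of $\vec a$ is denoted $a_i$ (similarly for $\vec b,\vec c$), and indices are taken modulo $m$. $\mathrm{rad}(N)$ is the product of the distinct prime divisors of $N$, with $\mathrm{rad}(1)=1$. An $(n,m)$-piecewise affine permutation ($(n,m)$-p.a.p.) is a permutation $\pi$ of $[1,n]$ such that there exist $\vec a,\vec b\in[1,n]^m$ and $\vec c\in\mathcal C(m)$ with the property that $\pi(x)=\Psi_n(a_ix+b_i)$ and $\Psi_m(\pi(x))=c_{i+1}$ for any $x\in[1,n]$ with $\Psi_m(x)=c_i$. In this case the triple $(\vec a,\vec b,\vec c)$ is called $(n,m)$-admissible and $\pi$ is the $(n,m)$-p.a.p. with parameters $(\vec a,\vec b,\vec c)$ (the permutation induced by the triple). *)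

theory Defs
  imports "HOL-Number_Theory.Number_Theory" "HOL-Combinatorics.Permutations"
begin

definition rad :: "nat \<Rightarrow> nat" where
  "rad N = (\<Prod>p\<in>prime_factors N. p)"

definition Psi :: "nat \<Rightarrow> nat \<Rightarrow> nat" where
  "Psi k a = (THE r. r \<in> {1..k} \<and> [r = a] (mod k))"

lemma Psi_unique_existence:
  fixes k a :: nat
  assumes "0 < k"
  shows "\<exists>!r. r \<in> {1..k} \<and> [r = a] (mod k)"
proof
  let ?r = "if a mod k = 0 then k else a mod k"
  show "?r \<in> {1..k} \<and> [?r = a] (mod k)"
    using assms by (auto simp: cong_def Suc_leI less_imp_le)
  fix r assume r: "r \<in> {1..k} \<and> [r = a] (mod k)"
  show "r = ?r"
  proof (cases "r = k")
    case True
    with r show ?thesis by (auto simp: cong_def)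
  next
    case False
    with r have "r < k" "r \<ge> 1" by auto
    with r show ?thesis by (auto simp: cong_def)
  qed
qed

(* A vector with m coordinates is a function nat => nat of which only the values at
   1, ..., m matter.  Indices are taken modulo m by applying Psi m to them; in particular
   Psi m 0 = m and Psi m (m + 1) = 1, so the predecessor i - 1 of an index i >= 1 can be
   formed on nat without truncation. *)

definition perm_vectors :: "nat \<Rightarrow> (nat \<Rightarrow> nat) set" where
  "perm_vectors m = {c. bij_betw c {1..m} {1..m}}"

(* f permutes S is the library's notion of a permutation of S, with f the identity
   outside S; hence the parameters determine the permutation as a function on nat. *)

definition pap_with_params ::
  "nat \<Rightarrow> nat \<Rightarrow> (nat \<Rightarrow> nat) \<Rightarrow> (nat \<Rightarrow> nat) \<Rightarrow> (nat \<Rightarrow> nat) \<Rightarrow> (nat \<Rightarrow> nat) \<Rightarrow> bool" where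
  "pap_with_params n m a b c f \<longleftrightarrow>
     f permutes {1..n} \<and>
     a \<in> {1..m} \<rightarrow> {1..n} \<and> b \<in> {1..m} \<rightarrow> {1..n} \<and> c \<in> perm_vectors m \<and>
     (\<forall>i\<in>{1..m}. \<forall>x\<in>{1..n}. Psi m x = c i \<longrightarrow>
        f x = Psi n (a i * x + b i) \<and> Psi m (f x) = c (Psi m (i + 1)))"

definition admissible ::
  "nat \<Rightarrow> nat \<Rightarrow> (nat \<Rightarrow> nat) \<Rightarrow> (nat \<Rightarrow> nat) \<Rightarrow> (nat \<Rightarrow> nat) \<Rightarrow> bool" where
  "admissible n m a b c \<longleftrightarrow> (\<exists>f. pap_with_params n m a b c f)"

(* (v_m, v_{m-1}, ..., v_1) *)
definition rev_vector :: "nat \<Rightarrow> (nat \<Rightarrow> nat) \<Rightarrow> nat \<Rightarrow> nat" where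
  "rev_vector m v = (\<lambda>j. v (m + 1 - j))"

definition inverse_system ::
  "nat \<Rightarrow> nat \<Rightarrow> (nat \<Rightarrow> nat) \<Rightarrow> (nat \<Rightarrow> nat) \<Rightarrow> (nat \<Rightarrow> nat) \<Rightarrow> nat \<Rightarrow> nat \<Rightarrow> bool" where
  "inverse_system m n\<^sub>1 A b c i x \<longleftrightarrow>
     [int x = int (c (Psi m (i - 1))) - int (A i) * int (c i)] (mod int m) \<and>
     [int x = - int (A i) * int (b (Psi m (i - 1)))] (mod int n\<^sub>1)"

end

theory Submission
  imports Defs
begin

text \<open>On the residue class of \<open>c\<^sub>i\<close> modulo \<open>m\<close>, multiplying
  \<open>y = a\<^sub>i\<^sub>-\<^sub>1 x + b\<^sub>i\<^sub>-\<^sub>1\<close> by \<open>A\<^sub>i\<close> and adding \<open>B\<^sub>i\<close> recovers \<open>x\<close>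
  modulo \<open>n\<^sub>1\<close> by the second congruence of the system and modulo \<open>m\<close> by the first one.
  Since \<open>n/m\<close> is coprime to \<open>n\<^sub>2\<close>, the least common multiple of \<open>m\<close> and \<open>n\<^sub>1\<close> is \<open>n\<close>,
  so \<open>x\<close> is recovered modulo \<open>n\<close>. The system is solvable because
  \<open>a\<^sub>i\<^sub>-\<^sub>1 c\<^sub>i\<^sub>-\<^sub>1 + b\<^sub>i\<^sub>-\<^sub>1 \<equiv> c\<^sub>i\<close> modulo \<open>m\<close>, which makes its two congruences compatible
  modulo \<open>gcd(m, n\<^sub>1)\<close>.\<close>

lemma Psi_eq_iff:
  assumes "0 < k"
  shows "Psi k a = r \<longleftrightarrow> r \<in> {1..k} \<and> [r = a] (mod k)"
  using theI'[OF Psi_unique_existence[OF assms, of a]] Psi_unique_existence[OF assms, of a]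
  unfolding Psi_def by blast

lemma Psi_mem: "0 < k \<Longrightarrow> Psi k a \<in> {1..k}"
  using Psi_eq_iff by blast

lemma Psi_cong: "0 < k \<Longrightarrow> [Psi k a = a] (mod k)"
  using Psi_eq_iff by blast

lemma Psi_self: "r \<in> {1..k} \<Longrightarrow> Psi k r = r"
  by (subst Psi_eq_iff) auto

lemma Psi_succ_period: "0 < k \<Longrightarrow> Psi k (k + 1) = 1"
  by (subst Psi_eq_iff) (auto simp: cong_def simp del: add_Suc_right add_Suc simp flip: Suc_eq_plus1_left)

lemma Psi_zero: "0 < k \<Longrightarrow> Psi k 0 = k"
  by (subst Psi_eq_iff) (auto simp: cong_def)

text \<open>The wrap-around is the only delicate case: \<open>k = m\<close> forces
  \<open>i = 1\<close>, and then \<open>i - 1 = 0\<close> is sent back to \<open>m\<close>.\<close>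

lemma Psi_cyclic_pred:
  assumes "k \<in> {1..m}" "Psi m (k + 1) = i"
  shows "k = Psi m (i - 1)"
proof -
  have m: "0 < m" using assms(1) by simp
  show ?thesis
  proof (cases "k < m")
    case True
    then have "Psi m (k + 1) = k + 1" by (intro Psi_self) auto
    with assms show ?thesis by (simp add: Psi_self)
  next
    case False
    then have "k = m" using assms(1) by simp
    then show ?thesis using assms(2) Psi_succ_period[OF m] Psi_zero[OF m] by simp
  qed
qed

lemma Psi_cyclic_succ:
  assumes "i \<in> {1..m}"
  shows "Psi m (Psi m (i - 1) + 1) = i"
proof -
  have "[Psi m (i - 1) + 1 = i - 1 + 1] (mod m)"
    using assms by (intro cong_add Psi_cong) auto
  then show ?thesis using assms by (subst Psi_eq_iff) (auto intro: cong_sym)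
qed

text \<open>Reversal sends position \<open>j\<close> to \<open>i = m + 1 - j\<close>, so a cyclic
  step forward in \<open>j\<close> is a cyclic step back in \<open>i\<close>, to
  \<open>i - 1 = m - j\<close>. This is why the inverse runs through the residue classes in the
  reversed order.\<close>

lemma rev_vector_Psi_succ:
  assumes "j \<in> {1..m}"
  shows "rev_vector m v (Psi m (j + 1)) = v (Psi m (m - j))"
proof (cases "j < m")
  case True
  then have "Psi m (j + 1) = j + 1" "Psi m (m - j) = m - j" by (auto intro: Psi_self)
  then show ?thesis by (simp add: rev_vector_def)
next
  case False
  then have j: "j = m" using assms by simp
  then have "0 < m" using assms by simp
  with j show ?thesis using Psi_succ_period[of m] Psi_zero[of m] by (simp add: rev_vector_def)
qed

lemma rev_vector_mem_perm_vectors: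
  assumes "c \<in> perm_vectors m"
  shows "rev_vector m c \<in> perm_vectors m"
proof -
  have "bij_betw (\<lambda>j. m + 1 - j) {1..m} {1..m}"
    by (rule bij_betw_byWitness[where f' = "\<lambda>j. m + 1 - j"]) auto
  from bij_betw_trans[OF this] assms show ?thesis
    by (auto simp: perm_vectors_def rev_vector_def comp_def)
qed

lemma pap_class_index:
  assumes "0 < m" "c \<in> perm_vectors m"
  obtains k where "k \<in> {1..m}" "Psi m x = c k"
  using Psi_mem[OF assms(1), of x] assms(2)
  unfolding perm_vectors_def bij_betw_def by blast

text \<open>The entries of \<open>c\<close> exhaust the residue classes modulo \<open>m\<close>, so
  one of the affine rules prescribes the value at every point of \<open>{1..n}\<close>.\<close>

lemma pap_with_params_unique:
  assumes "pap_with_params n m a b c f" "pap_with_params n m a b c g" "0 < m" "x \<in> {1..n}"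
  shows "f x = g x"
proof -
  have "c \<in> perm_vectors m" using assms(1) by (simp add: pap_with_params_def)
  then obtain k where "k \<in> {1..m}" "Psi m x = c k"
    using pap_class_index assms(3) by blast
  then show ?thesis using assms unfolding pap_with_params_def by metis
qed

lemma pap_with_params_affine_cong:
  assumes "pap_with_params n m a b c f" "0 < m" "m dvd n" "i \<in> {1..m}"
    "x \<in> {1..n}" "Psi m x = c (Psi m (i - 1))"
  shows "[a (Psi m (i - 1)) * x + b (Psi m (i - 1)) = f x] (mod n)" "[f x = c i] (mod m)"
proof -
  have k: "Psi m (i - 1) \<in> {1..m}" using assms Psi_mem by blast
  have f: "f x = Psi n (a (Psi m (i - 1)) * x + b (Psi m (i - 1)))" "Psi m (f x) = c i"
    using assms(1,5,6) k Psi_cyclic_succ[OF assms(4)] unfolding pap_with_params_def by metis+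
  have "0 < n" using assms(5) by simp
  then show "[a (Psi m (i - 1)) * x + b (Psi m (i - 1)) = f x] (mod n)"
    unfolding f(1) by (intro cong_sym[OF Psi_cong])
  show "[f x = c i] (mod m)" using f(2) Psi_cong[OF assms(2), of "f x"] by (simp add: cong_sym_eq)
qed

text \<open>Here \<open>n\<^sub>2\<close> divides \<open>m * q\<close> and is coprime to
  \<open>q\<close>, so \<open>m = k * n\<^sub>2\<close> and hence \<open>n\<^sub>1 = k * q\<close>.
  After cancelling \<open>k\<close>, coprimality again lets \<open>q\<close> pass to the cofactor of
  \<open>m\<close> in \<open>d\<close>.\<close>

lemma dvd_of_dvd_of_coprime_quotient:
  fixes n\<^sub>1 n\<^sub>2 m q :: nat and d :: int
  assumes "n\<^sub>1 * n\<^sub>2 = m * q" "coprime n\<^sub>2 q" "0 < m" "int m dvd d" "int n\<^sub>1 dvd d"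
  shows "int (m * q) dvd d"
proof -
  have "n\<^sub>2 dvd m" using assms(1,2) by (metis coprime_dvd_mult_left_iff dvd_triv_right)
  then obtain k where k: "m = k * n\<^sub>2" by (metis dvdE mult.commute)
  with assms(1,3) have n1: "n\<^sub>1 = k * q" by simp
  have k0: "k \<noteq> 0" using k assms(3) by auto
  from assms(4) k obtain e where e: "d = int k * (int n\<^sub>2 * e)"
    by (metis dvdE mult.assoc of_nat_mult)
  have "int q dvd int n\<^sub>2 * e" using assms(5) n1 e k0 by simp
  then have "int q dvd e" using assms(2) by (simp add: coprime_dvd_mult_right_iff coprime_commute)
  then show ?thesis using k0 by (simp add: k e mult.assoc)
qed

text \<open>Chinese remaindering for moduli that need not be coprime. With
  \<open>v - u = gcd m n * e\<close> and a Bezout coefficient \<open>s\<close>, adding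
  \<open>m * s * e\<close> to \<open>u\<close> keeps the residue modulo \<open>m\<close> and turns
  it into that of \<open>v\<close> modulo \<open>n\<close>.\<close>

lemma cong_system_solvable:
  fixes u v m n :: int
  assumes "gcd m n dvd v - u"
  obtains x where "[x = u] (mod m)" "[x = v] (mod n)"
proof -
  from assms obtain e where e: "v - u = gcd m n * e" by auto
  obtain s where "[m * s = gcd m n] (mod n)" using cong_solve_int by blast
  then have "[u + m * s * e = u + gcd m n * e] (mod n)" by (intro cong_add cong_mult) auto
  moreover have "u + gcd m n * e = v" using e by simp
  ultimately have "[u + m * (s * e) = v] (mod n)" by (simp add: mult.assoc)
  moreover have "[u + m * (s * e) = u] (mod m)" by (simp add: cong_def)
  ultimately show thesis using that by blast
qed

lemma ex_representative:
  assumes "0 < n"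
  obtains r where "r \<in> {1..n}" "[int r = x] (mod int n)"
proof
  show "Psi n (nat (x mod int n)) \<in> {1..n}" using assms by (rule Psi_mem)
  have "[int (Psi n (nat (x mod int n))) = int (nat (x mod int n))] (mod int n)"
    using Psi_cong[OF assms] by (simp only: cong_int_iff)
  then show "[int (Psi n (nat (x mod int n))) = x] (mod int n)"
    using assms by (simp add: cong_def)
qed

theorem theorem2p7:
  fixes n m n\<^sub>1 n\<^sub>2 :: nat
    and a b c A f :: "nat \<Rightarrow> nat"
  assumes "n > 0" and "m > 1" and "m dvd n"
    and "n = n\<^sub>1 * n\<^sub>2" and "rad n\<^sub>1 dvd n div m" and "gcd n\<^sub>2 (n div m) = 1"
    and "admissible n m a b c"
    and "pap_with_params n m a b c f"
    and "\<forall>i\<in>{1..m}. A i \<in> {1..n\<^sub>1} \<and> [A i * a (Psi m (i - 1)) = 1] (mod n\<^sub>1)"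
  shows "(\<forall>i\<in>{1..m}. \<exists>x\<in>{1..n}. inverse_system m n\<^sub>1 A b c i x) \<and>
    (\<forall>B. (\<forall>i\<in>{1..m}. B i \<in> {1..n} \<and> inverse_system m n\<^sub>1 A b c i (B i)) \<longrightarrow>
       admissible n m (rev_vector m A) (rev_vector m B) (rev_vector m c) \<and>
       (\<forall>g. pap_with_params n m (rev_vector m A) (rev_vector m B) (rev_vector m c) g \<longrightarrow>
          (\<forall>y\<in>{1..n}. f (g y) = y \<and> g (f y) = y)))"
proof (intro conjI allI impI ballI)
  define q where "q = n div m"
  \<comment> \<open>The cyclic predecessor, with \<open>p 1 = m\<close>.\<close>
  define p where "p i = Psi m (i - 1)" for i
  have m: "0 < m" using assms(2) by simp
  have q: "n\<^sub>1 * n\<^sub>2 = m * q" using assms(3,4) by (simp add: q_def)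
  have cop: "coprime n\<^sub>2 q" using assms(6) unfolding q_def by (rule gcd_eq_1_imp_coprime)
  have n1: "n\<^sub>1 dvd n" "0 < n\<^sub>1" "n\<^sub>1 \<le> n" using assms(1,4) by auto
  have mn: "m \<le> n" using assms(1,3) by (rule dvd_imp_le[rotated])
  have f: "f permutes {1..n}" and c: "c \<in> perm_vectors m"
    using assms(8) by (auto simp: pap_with_params_def)
  have bij: "bij_betw c {1..m} {1..m}" using c by (simp add: perm_vectors_def)
  have A: "A i \<in> {1..n\<^sub>1}" "[int (A i) * int (a (p i)) = 1] (mod int n\<^sub>1)"
    if "i \<in> {1..m}" for i
    using assms(9) that by (auto simp: p_def simp flip: cong_int_iff)
  note step = pap_with_params_affine_cong[OF assms(8) m assms(3), folded p_def]

  show "\<exists>x\<in>{1..n}. inverse_system m n\<^sub>1 A b c i x" if i: "i \<in> {1..m}" for i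
  proof -
    have "p i \<in> {1..m}" using m Psi_mem by (simp add: p_def)
    then have cp: "c (p i) \<in> {1..m}" using bij bij_betwE by blast
    \<comment> \<open>As \<open>m \<le> n\<close>, the entry \<open>c (p i)\<close> is itself a
      point of \<open>{1..n}\<close> in its own class, so the affine rule applies to it.\<close>
    then have "[a (p i) * c (p i) + b (p i) = c i] (mod m)"
      using step[OF i, of "c (p i)"] mn assms(3)
      by (auto simp: Psi_self intro: cong_trans cong_dvd_modulus_nat)
    then have "int m dvd int (a (p i)) * int (c (p i)) + int (b (p i)) - int (c i)"
      by (simp add: cong_iff_dvd_diff flip: cong_int_iff)
    then have 1: "gcd (int m) (int n\<^sub>1) dvd
        int (A i) * (int (a (p i)) * int (c (p i)) + int (b (p i)) - int (c i))"
      by (meson dvd_mult dvd_trans gcd_dvd1)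
    have "int n\<^sub>1 dvd int (A i) * int (a (p i)) - 1"
      using A(2)[OF i] by (simp add: cong_iff_dvd_diff)
    then have 2: "gcd (int m) (int n\<^sub>1) dvd (int (A i) * int (a (p i)) - 1) * int (c (p i))"
      by (meson dvd_mult2 dvd_trans gcd_dvd2)
    \<comment> \<open>The difference of the two right-hand sides is the term in \<open>2\<close>
      minus the term in \<open>1\<close>; the products \<open>A i * a (p i) * c (p i)\<close>
      cancel.\<close>
    have "gcd (int m) (int n\<^sub>1) dvd
        - int (A i) * int (b (p i)) - (int (c (p i)) - int (A i) * int (c i))"
      using dvd_diff[OF 2 1] by (simp add: algebra_simps)
    then obtain x where x: "[x = int (c (p i)) - int (A i) * int (c i)] (mod int m)"
      "[x = - int (A i) * int (b (p i))] (mod int n\<^sub>1)"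
      by (rule cong_system_solvable)
    obtain r where r: "r \<in> {1..n}" "[int r = x] (mod int n)"
      using ex_representative assms(1) by blast
    have "[int r = x] (mod int m)" "[int r = x] (mod int n\<^sub>1)"
      using r(2) assms(3) n1(1) by (auto intro: cong_dvd_modulus)
    then have "inverse_system m n\<^sub>1 A b c i r"
      unfolding inverse_system_def p_def[symmetric] using x by (blast intro: cong_trans)
    with r(1) show ?thesis by blast
  qed

  fix B
  assume B: "\<forall>i\<in>{1..m}. B i \<in> {1..n} \<and> inverse_system m n\<^sub>1 A b c i (B i)"
  have recover: "[A i * f x + B i = x] (mod n)"
    if i: "i \<in> {1..m}" and x: "x \<in> {1..n}" "Psi m x = c (p i)" for i x
  proof -
    have Bi: "int m dvd int (B i) - (int (c (p i)) - int (A i) * int (c i))"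
      "int n\<^sub>1 dvd int (B i) + int (A i) * int (b (p i))"
      using B i by (auto simp: inverse_system_def p_def cong_iff_dvd_diff)
    have fx: "int m dvd int (f x) - int (c i)"
      using step(2)[OF i x] by (simp add: cong_iff_dvd_diff flip: cong_int_iff)
    have "[c (p i) = x] (mod m)" using x(2) Psi_cong[OF m, of x] by simp
    then have cx: "int m dvd int (c (p i)) - int x"
      by (simp add: cong_iff_dvd_diff flip: cong_int_iff)
    \<comment> \<open>Modulo \<open>m\<close> no inverse of \<open>a (p i)\<close> is available, so
      the regrouping uses only the classes of \<open>x\<close> and \<open>f x\<close>. Modulo
      \<open>n\<^sub>1\<close>, below, the affine rule and the inverse \<open>A i\<close> are used
      instead.\<close>
    have "int (A i) * int (f x) + int (B i) - int x
        = int (A i) * (int (f x) - int (c i))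
          + (int (B i) - (int (c (p i)) - int (A i) * int (c i)))
          + (int (c (p i)) - int x)"
      by (simp add: algebra_simps)
    then have dm: "int m dvd int (A i) * int (f x) + int (B i) - int x"
      by (simp only:) (intro dvd_add dvd_mult Bi(1) fx cx)
    have "[a (p i) * x + b (p i) = f x] (mod n\<^sub>1)"
      using step(1)[OF i x] n1(1) by (rule cong_dvd_modulus_nat)
    then have fx1: "int n\<^sub>1 dvd int (a (p i)) * int x + int (b (p i)) - int (f x)"
      by (simp add: cong_iff_dvd_diff flip: cong_int_iff)
    have Aa: "int n\<^sub>1 dvd int (A i) * int (a (p i)) - 1"
      using A(2)[OF i] by (simp add: cong_iff_dvd_diff)
    have "int (A i) * int (f x) + int (B i) - int x
        = (int (B i) + int (A i) * int (b (p i)))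
          + (int (A i) * int (a (p i)) - 1) * int x
          - int (A i) * (int (a (p i)) * int x + int (b (p i)) - int (f x))"
      by (simp add: algebra_simps)
    then have "int n\<^sub>1 dvd int (A i) * int (f x) + int (B i) - int x"
      by (simp only:) (intro dvd_diff dvd_add dvd_mult[OF fx1] dvd_mult2[OF Aa] Bi(2))
    from dvd_of_dvd_of_coprime_quotient[OF q cop m dm this]
    have "int n dvd int (A i) * int (f x) + int (B i) - int x"
      using q assms(4) by simp
    then show ?thesis by (simp add: cong_iff_dvd_diff flip: cong_int_iff)
  qed

  \<comment> \<open>Admissibility of the reversed triple needs a permutation as witness, and the
    actual inverse of \<open>f\<close> serves.\<close>
  have inverse: "pap_with_params n m (rev_vector m A) (rev_vector m B) (rev_vector m c)
      (inv_into UNIV f)"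
    unfolding pap_with_params_def
  proof (intro conjI ballI impI)
    show "inv_into UNIV f permutes {1..n}" using f by (rule permutes_inv)
    have ri: "m + 1 - j \<in> {1..m}" if "j \<in> {1..m}" for j using that by auto
    show "rev_vector m A \<in> {1..m} \<rightarrow> {1..n}"
    proof
      fix j assume "j \<in> {1..m}"
      from A(1)[OF ri[OF this]] n1(3) show "rev_vector m A j \<in> {1..n}"
        by (simp add: rev_vector_def)
    qed
    show "rev_vector m B \<in> {1..m} \<rightarrow> {1..n}"
      using B ri by (simp add: rev_vector_def Pi_iff)
    show "rev_vector m c \<in> perm_vectors m" using c by (rule rev_vector_mem_perm_vectors)
    fix j y assume j: "j \<in> {1..m}" and y: "y \<in> {1..n}" and yc: "Psi m y = rev_vector m c j"
    define i where "i = m + 1 - j"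
    define x where "x = inv_into UNIV f y"
    have i: "i \<in> {1..m}" using ri[OF j] by (simp add: i_def)
    have fx: "f x = y" using f by (simp add: x_def permutes_inverses)
    have x: "x \<in> {1..n}" using y permutes_inv[OF f] by (simp only: x_def permutes_in_image)
    \<comment> \<open>The class of the preimage \<open>x\<close> is found by pushing it forward:
      \<open>f\<close> moves class \<open>c k\<close> to the next one, which is \<open>c i\<close>,
      and injectivity of \<open>c\<close> gives \<open>k = p i\<close>.\<close>
    obtain k where k: "k \<in> {1..m}" "Psi m x = c k" using pap_class_index m c by blast
    then have "Psi m (f x) = c (Psi m (k + 1))"
      using assms(8) x unfolding pap_with_params_def by blast
    then have "c (Psi m (k + 1)) = c i" using fx yc by (simp add: rev_vector_def i_def)
    then have "Psi m (k + 1) = i"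
      using bij i Psi_mem[OF m] by (auto simp: bij_betw_def dest: inj_onD)
    then have kp: "k = p i" using k(1) Psi_cyclic_pred by (simp add: p_def)
    show "inv_into UNIV f y = Psi n (rev_vector m A j * y + rev_vector m B j)"
      using Psi_eq_iff[OF assms(1)] recover[OF i x] k(2) kp x fx
      by (metis cong_sym i_def rev_vector_def x_def)
    show "Psi m (inv_into UNIV f y) = rev_vector m c (Psi m (j + 1))"
      using k(2) kp unfolding rev_vector_Psi_succ[OF j] by (simp add: p_def i_def flip: x_def)
  qed
  then show "admissible n m (rev_vector m A) (rev_vector m B) (rev_vector m c)"
    unfolding admissible_def by blast
  fix g y
  assume g: "pap_with_params n m (rev_vector m A) (rev_vector m B) (rev_vector m c) g"
    and y: "y \<in> {1..n}"
  \<comment> \<open>By uniqueness \<open>g\<close> agrees with the inverse of \<open>f\<close> on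
    \<open>{1..n}\<close>; for \<open>g (f y)\<close> this requires \<open>f y\<close> to lie
    there.\<close>
  have "f y \<in> {1..n}" using f y by (simp only: permutes_in_image)
  then show "f (g y) = y" "g (f y) = y"
    using pap_with_params_unique[OF g inverse m] y f by (simp_all add: permutes_inverses)
qed

end
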